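(* Consider the unconstrained problem $\min_{\mathrm{y}\in\mathbb{R}^n}\sum_{i\in\mathcal{A}} f_i(\mathrm{y})$ with $\mathcal{A}=\{1,\dots,N\}$. Consider agent systems $\Sigma_i$, $i\in\mathcal{A}$, and controller systems $\Pi_k$, $k\in\mathcal{C}=\{1,\dots,K\}$, interconnected by $\zeta=(E\otimes I_n)^\top y$ and $u=-(E\otimes I_n)d$, where $E\in\mathbb{R}^{N\times K}$ is the incidence matrix of a connected communication graph. Suppose that every equilibrium $(\bar x_i,\bar u_i,\bar y_i)$ of each agent system $\Sigma_i$ fulfills $$\bar u_i=\nabla f_i(\bar y_i),$$ and that every controller $\Pi_k$ is a system with integral action. Then all equilibria $(\bar y,\bar d)$ of the networked system lie in the manifold $$\mathcal{M}_{\mathrm{eq}}=\{(\bar y,\bar d)\in\mathbb{R}^{Nn}\times\mathbb{R}^{Kn}\mid \bar y=1_N\otimes \mathrm{y}^*\},$$ where $\mathrm{y}^*$ is the minimizer of the problem.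
   Context: Standing assumptions: the functions $f_i:\mathbb{R}^n\to\mathbb{R}$ are differentiable and the optimization problem is strictly convex (the sum $\sum_i f_i$ is strictly convex), so the minimizer $\mathrm{y}^*$ is unique. Agent systems: $\Sigma_i:\ \dot x_i=\chi_i(x_i,u_i),\ y_i=\psi_i(x_i,u_i)$ with $\chi_i,\psi_i:\mathbb{R}^n\times\mathbb{R}^n\to\mathbb{R}^n$. An equilibrium $(\bar x_i,\bar u_i,\bar y_i)$ satisfies $\chi_i(\bar x_i,\bar u_i)=0$ and $\bar y_i=\psi_i(\bar x_i,\bar u_i)$. Controller systems: $\Pi_k:\ \dot z_k=\Phi_k(z_k,\zeta_k),\ d_k=\sigma_k(z_k)$ with $\Phi_k:\mathbb{R}^n\times\mathbb{R}^n\to\mathbb{R}^n$, $\sigma_k:\mathbb{R}^n\to\mathbb{R}^n$. A system has integral action if no input other than the zero input leads to an equilibrium, i.e. $\Phi_k(\bar z_k,\bar\zeta_k)=0$ implies $\bar\zeta_k=0$. Stacked variables: $y=\mathrm{col}(y_i)$, $u=\mathrm{col}(u_i)$, $\zeta=\mathrm{col}(\zeta_k)$, $d=\mathrm{col}(d_k)$. An equilibrium of the networked system consists of equilibria of all $\Sigma_i$ and $\Pi_k$ whose inputs and outputs satisfy the interconnection equations. Incidence matrix: the nodes of the graph are the agents, its edges are in bijection with the controllers, and (after fixing an arbitrary orientation of the edges) $E=(m_{ij})$ with $m_{ij}=-1$ if edge $j$ leaves node $i$, $m_{ij}=1$ if edge $j$ enters node $i$, and $m_{ij}=0$ otherwise.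 $1_N$ is the all-ones vector. *)

theory Defs
  imports "HOL-Analysis.Analysis" "Graph_Theory.Graph_Theory"
begin

definition strictly_convex :: "('a::real_vector \<Rightarrow> real) \<Rightarrow> bool" where
  "strictly_convex F \<longleftrightarrow>
     (\<forall>x y t. x \<noteq> y \<and> 0 < t \<and> t < 1 \<longrightarrow>
        F ((1 - t) *\<^sub>R x + t *\<^sub>R y) < (1 - t) * F x + t * F y)"

text \<open>
  Vectors and matrices whose rows or columns are indexed by a finite set of agents or edges are
  real-valued functions of the indices that vanish outside the index set. With \<^typ>\<open>'n\<close> the
  index type of the coordinates of a single block, \<^term>\<open>stacked_space I\<close> plays the role of the
  space of dimension |I|n, and \<^term>\<open>col I v\<close> stacks the blocks \<^term>\<open>v i\<close>, \<^term>\<open>i \<in> I\<close>.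
\<close>

definition stacked_space :: "'i set \<Rightarrow> ('i \<times> 'n \<Rightarrow> real) set" where
  "stacked_space I = {w. \<forall>i r. i \<notin> I \<longrightarrow> w (i, r) = 0}"

definition col :: "'i set \<Rightarrow> ('i \<Rightarrow> real ^ 'n) \<Rightarrow> 'i \<times> 'n \<Rightarrow> real" where
  "col I v = (\<lambda>(i, r). if i \<in> I then v i $ r else 0)"

definition ones :: "'i set \<Rightarrow> 'i \<Rightarrow> real" where
  "ones I i = (if i \<in> I then 1 else 0)"

definition kron_vec :: "('i \<Rightarrow> real) \<Rightarrow> real ^ 'n \<Rightarrow> 'i \<times> 'n \<Rightarrow> real" where
  "kron_vec v w = (\<lambda>(i, r). v i * w $ r)"

definition kron_mat ::
  "('i \<Rightarrow> 'j \<Rightarrow> real) \<Rightarrow> real ^ 'n ^ 'm \<Rightarrow> 'i \<times> 'm \<Rightarrow> 'j \<times> 'n \<Rightarrow> real" where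
  "kron_mat A B = (\<lambda>(i, r) (j, s). A i j * B $ r $ s)"

definition transp_mat :: "('p \<Rightarrow> 'q \<Rightarrow> real) \<Rightarrow> 'q \<Rightarrow> 'p \<Rightarrow> real" where
  "transp_mat A q p = A p q"

text \<open>The column index set is an explicit argument because it is the range of summation.\<close>

definition mat_vec :: "'q set \<Rightarrow> ('p \<Rightarrow> 'q \<Rightarrow> real) \<Rightarrow> ('q \<Rightarrow> real) \<Rightarrow> 'p \<Rightarrow> real" where
  "mat_vec Q A w p = (\<Sum>q\<in>Q. A p q * w q)"

text \<open>
  The communication graph together with the chosen orientation of its edges is a digraph.
  In a loop-free digraph the first two cases below exclude each other.
\<close>

definition incidence_matrix :: "('a, 'b) pre_digraph \<Rightarrow> 'a \<Rightarrow> 'b \<Rightarrow> real" where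
  "incidence_matrix G i k =
     (if k \<in> arcs G \<and> tail G k = i then - 1
      else if k \<in> arcs G \<and> head G k = i then 1
      else 0)"

definition agent_equilibrium ::
  "(real ^ 'n \<Rightarrow> real ^ 'n \<Rightarrow> real ^ 'n) \<Rightarrow> (real ^ 'n \<Rightarrow> real ^ 'n \<Rightarrow> real ^ 'n) \<Rightarrow>
   real ^ 'n \<Rightarrow> real ^ 'n \<Rightarrow> real ^ 'n \<Rightarrow> bool" where
  "agent_equilibrium chi \<psi> x u y \<longleftrightarrow> chi x u = 0 \<and> y = \<psi> x u"

definition controller_equilibrium ::
  "(real ^ 'n \<Rightarrow> real ^ 'n \<Rightarrow> real ^ 'n) \<Rightarrow> (real ^ 'n \<Rightarrow> real ^ 'n) \<Rightarrow>
   real ^ 'n \<Rightarrow> real ^ 'n \<Rightarrow> real ^ 'n \<Rightarrow> bool" where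
  "controller_equilibrium \<Phi> \<sigma> z \<zeta> d \<longleftrightarrow> \<Phi> z \<zeta> = 0 \<and> d = \<sigma> z"

definition integral_action :: "(real ^ 'n \<Rightarrow> real ^ 'n \<Rightarrow> real ^ 'n) \<Rightarrow> bool" where
  "integral_action \<Phi> \<longleftrightarrow> (\<forall>z \<zeta>. \<Phi> z \<zeta> = 0 \<longrightarrow> \<zeta> = 0)"

text \<open>
  Equilibria of the network with agents \<^term>\<open>A\<close>, controllers \<^term>\<open>C\<close> and interconnection matrix
  \<^term>\<open>E\<close>, recorded by their stacked outputs.
\<close>

definition network_equilibria ::
  "'a set \<Rightarrow> 'c set \<Rightarrow> ('a \<Rightarrow> 'c \<Rightarrow> real) \<Rightarrow>
   ('a \<Rightarrow> real ^ 'n \<Rightarrow> real ^ 'n \<Rightarrow> real ^ 'n) \<Rightarrow> ('a \<Rightarrow> real ^ 'n \<Rightarrow> real ^ 'n \<Rightarrow> real ^ 'n) \<Rightarrow>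
   ('c \<Rightarrow> real ^ 'n \<Rightarrow> real ^ 'n \<Rightarrow> real ^ 'n) \<Rightarrow> ('c \<Rightarrow> real ^ 'n \<Rightarrow> real ^ 'n) \<Rightarrow>
   (('a \<times> 'n \<Rightarrow> real) \<times> ('c \<times> 'n \<Rightarrow> real)) set" where
  "network_equilibria A C E chi \<psi> \<Phi> \<sigma> =
     {(col A y, col C d) | y d. \<exists>x u z \<zeta>.
        (\<forall>i\<in>A. agent_equilibrium (chi i) (\<psi> i) (x i) (u i) (y i)) \<and>
        (\<forall>k\<in>C. controller_equilibrium (\<Phi> k) (\<sigma> k) (z k) (\<zeta> k) (d k)) \<and>
        col C \<zeta> = mat_vec (A \<times> UNIV) (transp_mat (kron_mat E (mat 1 :: real ^ 'n ^ 'n))) (col A y) \<and>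
        col A u = - mat_vec (C \<times> UNIV) (kron_mat E (mat 1 :: real ^ 'n ^ 'n)) (col C d)}"

definition equilibrium_manifold ::
  "'a set \<Rightarrow> 'c set \<Rightarrow> real ^ 'n \<Rightarrow> (('a \<times> 'n \<Rightarrow> real) \<times> ('c \<times> 'n \<Rightarrow> real)) set" where
  "equilibrium_manifold A C ystar =
     {(y, d). y \<in> stacked_space A \<and> d \<in> stacked_space C \<and> y = kron_vec (ones A) ystar}"

end

theory Submission
  imports Defs
begin

text \<open>
  Integral action forces \<open>\<zeta> = 0\<close>, that is, the outputs of the two ends of every edge agree; by
  connectedness all agents share one output \<open>c\<close>. Since each column of the incidence matrix sums to
  zero, so do the blocks of \<open>u = - (E \<otimes> I) d\<close>, whatever \<open>d\<close> is. As the blocks of \<open>u\<close> are the gradients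
  of the \<open>f i\<close> at \<open>c\<close>, the point \<open>c\<close> is critical for the strictly convex sum, hence its minimizer.
\<close>

text \<open>If some other point were no higher than \<open>c\<close>, strict convexity would place
  \<open>F\<close> below a strictly descending chord issuing from \<open>c\<close>, which
  contradicts a vanishing derivative there.\<close>

lemma strictly_convex_critical_point_less:
  fixes F :: "'a::real_normed_vector \<Rightarrow> real"
  assumes conv: "strictly_convex F"
    and crit: "(F has_derivative (\<lambda>_. 0)) (at c)"
    and "x \<noteq> c"
  shows "F c < F x"
proof (rule ccontr)
  assume "\<not> F c < F x"
  \<comment> \<open>Passing to the midpoint turns the weak inequality \<open>F x \<le> F c\<close>
    into the strict one \<open>F m < F c\<close>, so that the chord from \<open>c\<close> to
    \<open>m\<close> has negative slope.\<close>
  define m where "m = (1 - 1/2) *\<^sub>R c + (1/2) *\<^sub>R x"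
  have "F m < (1 - 1/2) * F c + (1/2) * F x"
    using conv[unfolded strictly_convex_def, rule_format, of c x "1/2"] \<open>x \<noteq> c\<close>
    by (simp add: m_def)
  with \<open>\<not> F c < F x\<close> have less: "F m < F c" by simp
  then have "c \<noteq> m" by auto
  \<comment> \<open>Up to the constant \<open>F c\<close>, this is \<open>F\<close> along the
    segment minus its chord. Convexity makes it drop below \<open>h 0\<close> inside the segment,
    while its derivative at 0 is positive.\<close>
  define h where "h s = F ((1 - s) *\<^sub>R c + s *\<^sub>R m) + s * (F c - F m)" for s
  \<comment> \<open>Here \<open>c\<close> is written as the segment point with parameter 0, the form
    that the chain rule needs.\<close>
  have "(F has_derivative (\<lambda>_. 0)) (at ((1 - 0) *\<^sub>R c + 0 *\<^sub>R m))"
    using crit by simp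
  moreover have "((\<lambda>s. (1 - s) *\<^sub>R c + s *\<^sub>R m) has_derivative (\<lambda>t. t *\<^sub>R (m - c))) (at 0)"
    by (auto intro!: derivative_eq_intros simp: algebra_simps)
  ultimately have "((\<lambda>s. F ((1 - s) *\<^sub>R c + s *\<^sub>R m)) has_derivative (\<lambda>_. 0)) (at 0)"
    using has_derivative_compose by fastforce
  then have "((\<lambda>s. F ((1 - s) *\<^sub>R c + s *\<^sub>R m)) has_real_derivative 0) (at 0)"
    by (simp add: has_field_derivative_def lambda_zero)
  then have "(h has_real_derivative F c - F m) (at 0)"
    unfolding h_def by (auto intro!: derivative_eq_intros)
  with less obtain \<epsilon> where \<epsilon>: "\<epsilon> > 0" "\<And>s. 0 < s \<Longrightarrow> s < \<epsilon> \<Longrightarrow> h 0 < h s"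
    using DERIV_pos_inc_right[of h "F c - F m" 0] by auto
  define s where "s = min \<epsilon> 1 / 2"
  have s: "0 < s" "s < \<epsilon>" "s < 1" using \<epsilon>(1) by (auto simp: s_def min_def)
  have "F ((1 - s) *\<^sub>R c + s *\<^sub>R m) < (1 - s) * F c + s * F m"
    using conv \<open>c \<noteq> m\<close> s unfolding strictly_convex_def by blast
  then have "h s < h 0" by (simp add: h_def algebra_simps)
  with \<epsilon>(2)[OF s(1,2)] show False by simp
qed

text \<open>The identity factor leaves one term of the sum over coordinates, so the Kronecker
  product acts on each coordinate separately.\<close>

lemma mat_vec_transp_kron_id:
  fixes v :: "'i \<Rightarrow> real ^ 'n"
  shows "mat_vec (A \<times> UNIV) (transp_mat (kron_mat E (mat 1 :: real ^ 'n ^ 'n))) (col A v) (k, r)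
    = (\<Sum>i\<in>A. E i k * v i $ r)"
proof -
  have "(\<Sum>s\<in>UNIV. E i k * (mat 1 :: real ^ 'n ^ 'n) $ s $ r * col A v (i, s)) = E i k * v i $ r"
    if "i \<in> A" for i
    using that by (simp add: col_def mat_def if_distrib if_distribR cong: if_cong)
  then have "(\<Sum>i\<in>A. E i k * v i $ r)
    = (\<Sum>i\<in>A. \<Sum>s\<in>UNIV. E i k * (mat 1 :: real ^ 'n ^ 'n) $ s $ r * col A v (i, s))"
    by simp
  then show ?thesis
    by (simp only: mat_vec_def transp_mat_def kron_mat_def sum.cartesian_product case_prod_unfold
        prod.collapse fst_conv snd_conv)
qed

lemma mat_vec_kron_id:
  fixes v :: "'j \<Rightarrow> real ^ 'n"
  shows "mat_vec (C \<times> UNIV) (kron_mat E (mat 1 :: real ^ 'n ^ 'n)) (col C v) (i, r)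
    = (\<Sum>k\<in>C. E i k * v k $ r)"
proof -
  have "(\<Sum>s\<in>UNIV. E i k * (mat 1 :: real ^ 'n ^ 'n) $ r $ s * col C v (k, s)) = E i k * v k $ r"
    if "k \<in> C" for k
    using that by (simp add: col_def mat_def if_distrib if_distribR cong: if_cong)
  then have "(\<Sum>k\<in>C. E i k * v k $ r)
    = (\<Sum>k\<in>C. \<Sum>s\<in>UNIV. E i k * (mat 1 :: real ^ 'n ^ 'n) $ r $ s * col C v (k, s))"
    by simp
  then show ?thesis
    by (simp only: mat_vec_def kron_mat_def sum.cartesian_product case_prod_unfold
        prod.collapse fst_conv snd_conv)
qed

text \<open>Without loops, a column has exactly two nonzero entries. Taking for \<open>g\<close> a
  coordinate of the outputs gives the difference across an edge; taking \<open>g\<close> constant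
  gives the vanishing column sum.\<close>

lemma (in loopfree_digraph) sum_incidence_matrix:
  assumes "finite (verts G)" "k \<in> arcs G"
  shows "(\<Sum>i\<in>verts G. incidence_matrix G i k * g i) = g (head G k) - g (tail G k)"
proof -
  have "(\<Sum>i\<in>verts G. incidence_matrix G i k * g i)
    = (\<Sum>i\<in>verts G. (if i = head G k then g i else 0) - (if i = tail G k then g i else 0))"
    using assms(2) no_loops[of k] by (intro sum.cong) (auto simp: incidence_matrix_def)
  also have "\<dots> = g (head G k) - g (tail G k)"
    using assms by (simp add: sum_subtractf)
  finally show ?thesis .
qed

text \<open>Connectedness supplies a path in the symmetric closure. Each of its steps is an arc of
  \<open>G\<close> traversed in one direction or the other, and equality of end values is
  insensitive to direction.\<close>

lemma connected_imp_constant: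
  assumes "Digraph_Component.connected G"
    and edges: "\<And>e. e \<in> arcs G \<Longrightarrow> g (head G e) = g (tail G e)"
    and "u \<in> verts G" "v \<in> verts G"
  shows "g v = g u"
proof -
  have "u \<rightarrow>\<^sup>*\<^bsub>mk_symmetric G\<^esub> v"
    using assms by (auto simp: Digraph_Component.connected_def strongly_connected_def)
  then show ?thesis
    unfolding reachable_def
  proof (induction rule: rtrancl_on_induct)
    case (step x y)
    then show ?case using edges by (auto simp: parcs_mk_symmetric)
  qed simp
qed

theorem theorem8:
  fixes N K :: nat
    and f :: "nat \<Rightarrow> real ^ 'n \<Rightarrow> real"
    and ystar :: "real ^ 'n"
    and chi \<psi> :: "nat \<Rightarrow> real ^ 'n \<Rightarrow> real ^ 'n \<Rightarrow> real ^ 'n"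
    and \<Phi> :: "nat \<Rightarrow> real ^ 'n \<Rightarrow> real ^ 'n \<Rightarrow> real ^ 'n"
    and \<sigma> :: "nat \<Rightarrow> real ^ 'n \<Rightarrow> real ^ 'n"
    and G :: "(nat, nat) pre_digraph"
  assumes differentiable: "\<forall>i\<in>{1..N}. f i differentiable_on UNIV"
    and convex: "strictly_convex (\<lambda>y. \<Sum>i\<in>{1..N}. f i y)"
    and minimizer: "is_arg_min (\<lambda>y. \<Sum>i\<in>{1..N}. f i y) (\<lambda>_. True) ystar"
    and graph: "loopfree_digraph G" "verts G = {1..N}" "arcs G = {1..K}"
    and connected: "Digraph_Component.connected G"
    and agents: "\<forall>i\<in>{1..N}. \<forall>x u y. agent_equilibrium (chi i) (\<psi> i) x u y \<longrightarrow> (GDERIV (f i) y :> u)"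
    and controllers: "\<forall>k\<in>{1..K}. integral_action (\<Phi> k)"
  shows "network_equilibria {1..N} {1..K} (incidence_matrix G) chi \<psi> \<Phi> \<sigma>
           \<subseteq> equilibrium_manifold {1..N} {1..K} ystar"
proof -
  interpret loopfree_digraph G by (rule graph(1))
  let ?A = "{1..N}" and ?C = "{1..K}" and ?E = "incidence_matrix G"
  have "(col ?A y, col ?C d) \<in> equilibrium_manifold ?A ?C ystar"
    if ag: "\<forall>i\<in>?A. agent_equilibrium (chi i) (\<psi> i) (x i) (u i) (y i)"
      and ct: "\<forall>k\<in>?C. controller_equilibrium (\<Phi> k) (\<sigma> k) (z k) (\<zeta> k) (d k)"
      and \<zeta>: "col ?C \<zeta>
        = mat_vec (?A \<times> UNIV) (transp_mat (kron_mat ?E (mat 1 :: real ^ 'n ^ 'n))) (col ?A y)"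
      and u: "col ?A u = - mat_vec (?C \<times> UNIV) (kron_mat ?E (mat 1 :: real ^ 'n ^ 'n)) (col ?C d)"
    for x u y z \<zeta> d
  proof -
    have edge: "y (head G k) = y (tail G k)" if k: "k \<in> arcs G" for k
    proof -
      have "\<zeta> k = 0"
        using ct[rule_format, of k] controllers[rule_format, of k] k
        unfolding graph(3) controller_equilibrium_def integral_action_def by blast
      then have "(\<Sum>i\<in>?A. ?E i k * y i $ r) = 0" for r
        using fun_cong[OF \<zeta>, of "(k, r)"] mat_vec_transp_kron_id[of ?A ?E y k r]
        by (simp add: col_def split: if_splits)
      then show ?thesis
        using sum_incidence_matrix[OF _ k] graph by (simp add: vec_eq_iff)
    qed
    \<comment> \<open>Connectedness includes that the vertex set is nonempty, so there is an agent
      to define the common value.\<close>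
    obtain i0 where i0: "i0 \<in> ?A"
      using connected graph by (auto simp: Digraph_Component.connected_def strongly_connected_def)
    define c where "c = y i0"
    have y: "y i = c" if "i \<in> ?A" for i
      using connected_imp_constant[where g = y, OF connected edge, of i0 i] that i0 graph
      by (simp add: c_def)
    have "(\<Sum>i\<in>?A. u i) $ r = 0" for r
    proof -
      have "u i $ r = - (\<Sum>k\<in>?C. ?E i k * d k $ r)" if "i \<in> ?A" for i
        using that fun_cong[OF u, of "(i, r)"] mat_vec_kron_id[of ?C ?E d i r]
        by (simp add: col_def)
      then have "(\<Sum>i\<in>?A. u i $ r) = - (\<Sum>i\<in>?A. \<Sum>k\<in>?C. ?E i k * d k $ r)"
        by (simp add: sum_negf)
      also have "(\<Sum>i\<in>?A. \<Sum>k\<in>?C. ?E i k * d k $ r) = (\<Sum>k\<in>?C. \<Sum>i\<in>?A. ?E i k * d k $ r)"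
        by (rule sum.swap)
      \<comment> \<open>Within column \<open>k\<close> the factor \<open>d k $ r\<close> does not
        depend on \<open>i\<close>, so the head and tail terms cancel.\<close>
      also have "\<dots> = 0"
        using sum_incidence_matrix[where g = "\<lambda>_. d _ $ r"] graph by (intro sum.neutral) simp
      finally show ?thesis by simp
    qed
    then have sum_u: "(\<Sum>i\<in>?A. u i) = 0" by (simp add: vec_eq_iff)
    \<comment> \<open>Consensus matters here: all gradients are taken at the same point
      \<open>c\<close>, so they add up to the derivative of the sum.\<close>
    have "(f i has_derivative (\<lambda>h. h \<bullet> u i)) (at c)" if i: "i \<in> ?A" for i
      using agents[rule_format, OF i ag[rule_format, OF i]] by (simp add: gderiv_def y[OF i])
    then have "((\<lambda>v. \<Sum>i\<in>?A. f i v) has_derivative (\<lambda>h. \<Sum>i\<in>?A. h \<bullet> u i)) (at c)"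
      by (rule has_derivative_sum)
    then have "((\<lambda>v. \<Sum>i\<in>?A. f i v) has_derivative (\<lambda>_. 0)) (at c)"
      by (simp only: inner_sum_right[symmetric] sum_u inner_zero_right)
    \<comment> \<open>Were \<open>c\<close> different from \<open>ystar\<close>, the sum would be
      strictly smaller at \<open>c\<close> than at its minimizer.\<close>
    from strictly_convex_critical_point_less[OF convex this, of ystar] minimizer
    have "c = ystar" by (auto simp: is_arg_min_def)
    with y have "col ?A y = kron_vec (ones ?A) ystar"
      by (auto simp: col_def kron_vec_def ones_def fun_eq_iff)
    then show ?thesis
      by (auto simp: equilibrium_manifold_def stacked_space_def kron_vec_def ones_def col_def)
  qed
  then show ?thesis
    unfolding network_equilibria_def by (intro subsetI) (elim CollectE exE conjE, simp only:)
qed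

end
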